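(* Let $A$ and $B$ be permutations with $A$ pseudo-cancelable. If the equation $AX=B$ admits a solution (a permutation $X$), then the following procedure returns the solution maximizing the number of connected components: set $X=\mathbf{0}$; while $B\neq\mathbf{0}$, let $a$ and $b$ be the multiplicities of the cycle $C_{\ell(B)}$ in $A\,C_{\mathrm{alcm}_A B}$ and in $B$ respectively, and set $X\leftarrow X+\tfrac{b}{a}C_{\mathrm{alcm}_A B}$ and $B\leftarrow B-\tfrac{b}{a}A\,C_{\mathrm{alcm}_A B}$; if at any moment $|A|>|B|$ or $A\,C_{\mathrm{alcm}_A B}$ is not a submultiset of $B$, the procedure declares the quotient undefined; otherwise it returns the final $X$.
   Context: A permutation is a finite set with a bijection on it up to isomorphism, i.e. a multiset (sum) of cycles, $C_n$ denoting the cycle of length $n$ and $\mathbf{0}$ the empty permutation; $|A|$ is the number of states. Sum is disjoint union; product is the direct product of digraphs, so $C_aC_b=\gcd(a,b)\,C_{\lcm(a,b)}$. $A$ is a submultiset of $B$ if $B=A+C$ for some $C$, and then $B-A=C$. For nonzero $A$, $\ell(A)$ is the smallest cycle length in $A$; $A$ is pseudo-cancelable if every cycle length of $A$ is a multiple of $\ell(A)$. For integers $a\mid b$, $\mathrm{alcm}_a b$ is the smallest positive $c$ with $\lcm(a,c)=b$, and $\mathrm{alcm}_A B=\mathrm{alcm}_{\ell(A)}\ell(B)$. *)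

theory Defs
  imports "HOL-Library.Multiset" "HOL-Combinatorics.Orbits"
begin

(* A permutation up to isomorphism is the multiset of its cycle lengths: the cycle C_n is {#n#},
   the empty permutation is {#}, disjoint union is multiset sum, "submultiset" is \<subseteq>#, the
   number of connected components is size. *)
definition is_perm :: "nat multiset \<Rightarrow> bool" where
  "is_perm A \<longleftrightarrow> 0 \<notin># A"

definition states :: "nat multiset \<Rightarrow> nat" where
  "states A = sum_mset A"

(* Bilinear extension of C_a C_b = gcd(a,b) C_lcm(a,b); cycle_type_prod below shows that this
   is the direct product of digraphs. *)
definition perm_mult :: "nat multiset \<Rightarrow> nat multiset \<Rightarrow> nat multiset" (infixl "\<odot>" 70) where
  "A \<odot> B = (\<Sum>a\<in>#A. \<Sum>b\<in>#B. replicate_mset (gcd a b) (lcm a b))"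

definition ell :: "nat multiset \<Rightarrow> nat" where
  "ell A = Min (set_mset A)"

definition pseudo_cancelable :: "nat multiset \<Rightarrow> bool" where
  "pseudo_cancelable A \<longleftrightarrow> A \<noteq> {#} \<and> (\<forall>a\<in>#A. ell A dvd a)"

(* Meaningful for a dvd b. *)
definition alcm :: "nat \<Rightarrow> nat \<Rightarrow> nat" where
  "alcm a b = (LEAST c. 0 < c \<and> lcm a c = b)"

definition alcm_perm :: "nat multiset \<Rightarrow> nat multiset \<Rightarrow> nat" where
  "alcm_perm A B = alcm (ell A) (ell B)"

(* The result None means that the procedure declares the quotient undefined. Besides the two tests
   |A| > |B| and "A C_c is not a submultiset of B", it is also returned whenever the next step would
   be meaningless: alcm_A B does not exist, b/a is not an integer, or (b/a) A C_c cannot be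
   subtracted from B. Hence div and the truncated multiset difference are only used where they
   are exact. *)
function quotient_loop ::
    "nat multiset \<Rightarrow> nat multiset \<Rightarrow> nat multiset \<Rightarrow> nat multiset option" where
  "quotient_loop A X B =
    (if B = {#} then Some X
     else
       let c = alcm_perm A B;
           P = A \<odot> {#c#};
           a = count P (ell B);
           b = count B (ell B);
           q = b div a
       in
         if states A > states B \<or> \<not> P \<subseteq># B
           \<or> \<not> ell A dvd ell B \<or> \<not> a dvd b \<or> \<not> repeat_mset q P \<subseteq># B
         then None
         else quotient_loop A (X + replicate_mset q c) (B - repeat_mset q P))"
  by pat_completeness auto

termination
proof (relation "measure (\<lambda>(A, X, B). size B)", goal_cases)
  case 1
  show ?case by simp
next
  case (2 A X B c P a b q)
  have "ell B \<in># B"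
    using 2(1) unfolding ell_def by (intro Min_in) auto
  then have "b > 0" unfolding 2(5) by simp
  moreover have "a dvd b" "repeat_mset q P \<subseteq># B" using 2 by auto
  ultimately have "a > 0" "q > 0"
    unfolding 2(6) by (auto simp: dvd_pos_nat div_greater_zero_iff dvd_imp_le)
  then have "count (repeat_mset q P) (ell B) > 0" using 2(4) by simp
  then have "size (repeat_mset q P) > 0"
    by (metis count_empty less_numeral_extra(3) nonempty_has_size)
  then show ?case
    using \<open>repeat_mset q P \<subseteq># B\<close> size_mset_mono[of "repeat_mset q P" B]
    by (simp add: size_Diff_submset del: size_repeat_mset)
qed

declare quotient_loop.simps [simp del]

definition quotient_procedure :: "nat multiset \<Rightarrow> nat multiset \<Rightarrow> nat multiset option" where
  "quotient_procedure A B = quotient_loop A {#} B"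

text \<open>Agreement of the multiset encoding with finite sets equipped with a bijection.\<close>

definition cycle_type :: "'a set \<Rightarrow> ('a \<Rightarrow> 'a) \<Rightarrow> nat multiset" where
  "cycle_type S f = image_mset card (mset_set (orbit f ` S))"

lemma orbit_closed_subset:
  assumes "f \<in> S \<rightarrow> S" "x \<in> S"
  shows "orbit f x \<subseteq> S"
proof
  fix y assume "y \<in> orbit f x"
  then show "y \<in> S" using assms by induction auto
qed

lemma orbit_card_period:
  assumes S: "finite S" "bij_betw f S S" and x: "x \<in> S"
  shows "0 < card (orbit f x)" "x \<in> orbit f x"
    "(f ^^ m) x = x \<longleftrightarrow> card (orbit f x) dvd m"
proof -
  have cl: "(f ^^ n) x \<in> S" for n
    using S(2) x by (induction n) (auto simp: bij_betw_def)
  have inj: "inj_on (f ^^ n) S" for n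
    using bij_betw_funpow[OF S(2)] by (simp add: bij_betw_def)
  have "\<not> inj_on (\<lambda>n. (f ^^ n) x) (UNIV :: nat set)"
    using S(1) cl by (meson finite_imageD finite_subset image_subset_iff infinite_UNIV_nat)
  then obtain i j where ij: "i < j" "(f ^^ i) x = (f ^^ j) x"
    unfolding inj_on_def by (metis linorder_neqE_nat)
  have "(f ^^ i) ((f ^^ (j - i)) x) = (f ^^ i) x"
    using ij by (simp flip: funpow_add[THEN fun_cong, unfolded o_apply])
  then have per: "(f ^^ (j - i)) x = x"
    using inj cl x by (auto dest: inj_onD)
  define p where "p = (LEAST p. 0 < p \<and> (f ^^ p) x = x)"
  have p: "0 < p" "(f ^^ p) x = x"
    using LeastI[of "\<lambda>p. 0 < p \<and> (f ^^ p) x = x" "j - i"] ij(1) per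
    unfolding p_def by auto
  have least: "p \<le> n" if "0 < n" "(f ^^ n) x = x" for n
    unfolding p_def using that by (intro Least_le) auto
  have mod: "(f ^^ n) x = (f ^^ (n mod p)) x" for n
    using p(2) by (rule funpow_mod_eq[symmetric])
  show self: "x \<in> orbit f x"
    using p unfolding orbit_altdef by (intro CollectI exI[of _ p]) simp
  have orb: "orbit f x = (\<lambda>n. (f ^^ n) x) ` {..<p}"
  proof (intro subset_antisym subsetI)
    fix y assume "y \<in> orbit f x"
    then obtain n where "y = (f ^^ n) x" by (auto simp: orbit_altdef)
    then show "y \<in> (\<lambda>n. (f ^^ n) x) ` {..<p}" using mod[of n] p(1) by auto
  next
    fix y assume "y \<in> (\<lambda>n. (f ^^ n) x) ` {..<p}"
    then obtain n where "y = (f ^^ n) x" by auto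
    then show "y \<in> orbit f x" using funpow_in_orbit[OF self] by simp
  qed
  have "inj_on (\<lambda>n. (f ^^ n) x) {..<p}"
  proof (rule linorder_inj_onI')
    fix i j assume ij: "i \<in> {..<p}" "j \<in> {..<p}" "i < j"
    show "(f ^^ i) x \<noteq> (f ^^ j) x"
    proof
      assume "(f ^^ i) x = (f ^^ j) x"
      then have "(f ^^ i) ((f ^^ (j - i)) x) = (f ^^ i) x"
        using ij by (simp flip: funpow_add[THEN fun_cong, unfolded o_apply])
      then have "(f ^^ (j - i)) x = x"
        using inj cl x by (auto dest: inj_onD)
      with least[of "j - i"] ij show False by auto
    qed
  qed
  with orb have card: "card (orbit f x) = p" by (simp add: card_image)
  show "0 < card (orbit f x)" using card p(1) by simp
  show "(f ^^ m) x = x \<longleftrightarrow> card (orbit f x) dvd m"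
  proof -
    have "(f ^^ m) x = x \<longleftrightarrow> m mod p = 0"
      using mod[of m] least[of "m mod p"] p(1) by (metis funpow_0 gr0I leD mod_less_divisor)
    then show ?thesis by (simp add: card dvd_eq_mod_eq_0)
  qed
qed

lemma orbit_eqI_mem:
  assumes S: "finite S" "bij_betw f S S" and x: "x \<in> S" and y: "y \<in> orbit f x"
  shows "orbit f y = orbit f x"
proof (rule orbit_cyclic_eq3[OF _ y])
  show "cyclic_on f (orbit f x)"
    using orbit_card_period(2)[OF S x] by (auto intro: cyclic_on_singleI)
qed

lemma orbits_partition:
  assumes S: "finite S" "bij_betw f S S"
  shows "pairwise disjnt (orbit f ` S)" "\<Union> (orbit f ` S) = S"
proof -
  show "pairwise disjnt (orbit f ` S)"
    using orbit_eqI_mem[OF S] unfolding pairwise_def disjnt_def by blast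
  have "f \<in> S \<rightarrow> S" using S(2) by (auto simp: bij_betw_def)
  then show "\<Union> (orbit f ` S) = S"
    using orbit_closed_subset[of f S] orbit_card_period(2)[OF S] by blast
qed

lemma is_perm_cycle_type:
  assumes S: "finite S" "bij_betw f S S"
  shows "is_perm (cycle_type S f)"
proof -
  have "set_mset (cycle_type S f) = (\<lambda>x. card (orbit f x)) ` S"
    using S(1) by (simp add: cycle_type_def image_image)
  then show ?thesis
    using orbit_card_period(1)[OF S] unfolding is_perm_def by force
qed

lemma states_cycle_type:
  assumes S: "finite S" "bij_betw f S S"
  shows "states (cycle_type S f) = card S"
proof -
  have "finite O'" if "O' \<in> orbit f ` S" for O'
    using that orbits_partition(2)[OF S] S(1) by (metis Union_upper finite_subset)
  then have "card (\<Union> (orbit f ` S)) = sum card (orbit f ` S)"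
    by (intro card_Union_disjoint orbits_partition(1)[OF S])
  then show ?thesis
    by (simp add: states_def cycle_type_def orbits_partition(2)[OF S] sum_unfold_sum_mset)
qed

lemma cycle_type_Un:
  assumes S: "finite S" "bij_betw f S S" and T: "finite T" "bij_betw f T T" and "S \<inter> T = {}"
  shows "cycle_type (S \<union> T) f = cycle_type S f + cycle_type T f"
proof -
  have False if "O' \<in> orbit f ` S" "O' \<in> orbit f ` T" for O'
  proof -
    have "O' \<subseteq> S" "O' \<subseteq> T"
      using Union_upper[OF that(1)] Union_upper[OF that(2)]
      unfolding orbits_partition(2)[OF S] orbits_partition(2)[OF T] .
    moreover have "O' \<noteq> {}" using that(1) orbit_nonempty[of f] by auto
    ultimately show False using \<open>S \<inter> T = {}\<close> by blast
  qed
  then have "orbit f ` S \<inter> orbit f ` T = {}" by blast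
  then show ?thesis
    using S(1) T(1) by (simp add: cycle_type_def image_Un mset_set_Union)
qed

lemma cycle_type_UN:
  assumes "finite I" "\<And>i. i \<in> I \<Longrightarrow> finite (A i)" "\<And>i. i \<in> I \<Longrightarrow> bij_betw f (A i) (A i)"
    and "disjoint_family_on A I"
  shows "cycle_type (\<Union>i\<in>I. A i) f = (\<Sum>i\<in>I. cycle_type (A i) f)"
  using assms
proof (induction I rule: finite_induct)
  case empty
  show ?case by (simp add: cycle_type_def)
next
  case (insert i I)
  have disj: "A i \<inter> (\<Union>i\<in>I. A i) = {}" "disjoint_family_on A I"
    using insert.prems(3) insert.hyps(2) by (auto simp: disjoint_family_on_def)
  have bij: "bij_betw f (\<Union>i\<in>I. A i) (\<Union>i\<in>I. A i)"
    using disj(2) insert.prems(2) by (intro bij_betw_UNION_disjoint) auto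
  show ?case
    using insert disj bij by (simp add: cycle_type_Un)
qed

lemma bij_betw_orbit:
  assumes S: "finite S" "bij_betw f S S" and x: "x \<in> S"
  shows "bij_betw f (orbit f x) (orbit f x)"
proof -
  have sub: "orbit f x \<subseteq> S"
    using UN_upper[OF x, of "orbit f"] orbits_partition(2)[OF S] by simp
  have "inj_on f (orbit f x)"
    using inj_on_subset[OF bij_betw_imp_inj_on[OF S(2)] sub] .
  moreover have "f ` orbit f x \<subseteq> orbit f x" by (auto intro: orbit.step)
  ultimately show ?thesis
    using sub S(1) by (simp add: bij_betw_def endo_inj_surj finite_subset)
qed

lemma funpow_map_prod:
  fixes f :: "'a \<Rightarrow> 'a" and g :: "'b \<Rightarrow> 'b"
  shows "(map_prod f g ^^ n) (x, y) = ((f ^^ n) x, (g ^^ n) y)"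
  by (induction n) simp_all

theorem cycle_type_prod:
  assumes S: "finite S" "bij_betw f S S" and T: "finite T" "bij_betw g T T"
  shows "cycle_type (S \<times> T) (map_prod f g) = cycle_type S f \<odot> cycle_type T g"
proof -
  let ?h = "map_prod f g"
  let ?I = "orbit f ` S \<times> orbit g ` T"
  have block: "cycle_type (P \<times> Q) ?h = replicate_mset (gcd (card P) (card Q)) (lcm (card P) (card Q))"
    if PQ: "P \<in> orbit f ` S" "Q \<in> orbit g ` T" for P Q
  proof -
    obtain x y where xy: "x \<in> S" "P = orbit f x" "y \<in> T" "Q = orbit g y"
      using PQ by blast
    have P: "finite P" "bij_betw f P P"
      using bij_betw_orbit[OF S xy(1)] orbit_card_period(1)[OF S xy(1)]
      unfolding xy(2) by (simp_all add: card_ge_0_finite)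
    have Q: "finite Q" "bij_betw g Q Q"
      using bij_betw_orbit[OF T xy(3)] orbit_card_period(1)[OF T xy(3)]
      unfolding xy(4) by (simp_all add: card_ge_0_finite)
    have h: "finite (P \<times> Q)" "bij_betw ?h (P \<times> Q) (P \<times> Q)"
      using P Q by (auto intro: bij_betw_map_prod)
    have card_orb: "card (orbit ?h z) = lcm (card P) (card Q)" if zPQ: "z \<in> P \<times> Q" for z
    proof (rule dvd_antisym)
      obtain u v where z: "z = (u, v)" "u \<in> P" "v \<in> Q" using zPQ by (cases z) auto
      have orb: "orbit f u = P" "orbit g v = Q"
        using z xy orbit_eqI_mem[OF S] orbit_eqI_mem[OF T] by auto
      have iff: "card (orbit ?h z) dvd m \<longleftrightarrow> lcm (card P) (card Q) dvd m" for m
        using orbit_card_period(3)[OF h zPQ, of m] orbit_card_period(3)[OF P z(2), of m]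
          orbit_card_period(3)[OF Q z(3), of m]
        unfolding z(1) orb funpow_map_prod prod.inject by simp
      show "card (orbit ?h z) dvd lcm (card P) (card Q)"
        by (rule iffD2[OF iff dvd_refl])
      show "lcm (card P) (card Q) dvd card (orbit ?h z)"
        by (rule iffD1[OF iff dvd_refl])
    qed
    define k where "k = card (orbit ?h ` (P \<times> Q))"
    have "cycle_type (P \<times> Q) ?h
        = image_mset (\<lambda>_. lcm (card P) (card Q)) (mset_set (orbit ?h ` (P \<times> Q)))"
      unfolding cycle_type_def using h(1) card_orb by (intro image_mset_cong) auto
    then have ct: "cycle_type (P \<times> Q) ?h = replicate_mset k (lcm (card P) (card Q))"
      by (simp add: image_mset_const_eq k_def)
    then have "k * lcm (card P) (card Q) = card P * card Q"
      using states_cycle_type[OF h] by (simp add: states_def card_cartesian_product)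
    also have "\<dots> = gcd (card P) (card Q) * lcm (card P) (card Q)"
      by (rule prod_gcd_lcm_nat)
    finally have eq: "k * lcm (card P) (card Q) = gcd (card P) (card Q) * lcm (card P) (card Q)" .
    have "lcm (card P) (card Q) > 0"
      using orbit_card_period(1)[OF S xy(1)] orbit_card_period(1)[OF T xy(3)]
      unfolding xy(2,4) by (rule lcm_pos_nat)
    then have "k = gcd (card P) (card Q)"
      using eq by (metis mult_right_cancel less_not_refl)
    with ct show ?thesis by simp
  qed
  have "(\<Union>(P, Q)\<in>?I. P \<times> Q) = \<Union> (orbit f ` S) \<times> \<Union> (orbit g ` T)"
    by auto
  then have ST: "S \<times> T = (\<Union>(P, Q)\<in>?I. P \<times> Q)"
    by (simp only: orbits_partition(2)[OF S] orbits_partition(2)[OF T])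
  have "cycle_type (S \<times> T) ?h = (\<Sum>i\<in>?I. cycle_type (case i of (P, Q) \<Rightarrow> P \<times> Q) ?h)"
    unfolding ST
  proof (rule cycle_type_UN)
    show "finite ?I" using S(1) T(1) by simp
    show "finite (case i of (P, Q) \<Rightarrow> P \<times> Q)" if "i \<in> ?I" for i
      using that card_ge_0_finite[OF orbit_card_period(1)[OF S]]
        card_ge_0_finite[OF orbit_card_period(1)[OF T]] by auto
    show "bij_betw ?h (case i of (P, Q) \<Rightarrow> P \<times> Q) (case i of (P, Q) \<Rightarrow> P \<times> Q)" if "i \<in> ?I" for i
      using that bij_betw_orbit[OF S] bij_betw_orbit[OF T] by (auto intro!: bij_betw_map_prod)
    show "disjoint_family_on (\<lambda>(P, Q). P \<times> Q) ?I"
      unfolding disjoint_family_on_def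
    proof (intro ballI impI)
      fix i j assume ij: "i \<in> ?I" "j \<in> ?I" "i \<noteq> j"
      obtain P Q P' Q' where eq: "i = (P, Q)" "j = (P', Q')"
        by (cases i, cases j) blast
      have "P \<inter> P' = {} \<or> Q \<inter> Q' = {}"
      proof (cases "P = P'")
        case True
        with ij eq have "Q \<in> orbit g ` T" "Q' \<in> orbit g ` T" "Q \<noteq> Q'" by blast+
        then show ?thesis
          using pairwiseD[OF orbits_partition(1)[OF T]] unfolding disjnt_def by blast
      next
        case False
        with ij eq have "P \<in> orbit f ` S" "P' \<in> orbit f ` S" by blast+
        then show ?thesis
          using False pairwiseD[OF orbits_partition(1)[OF S]] unfolding disjnt_def by blast
      qed
      then show "(case i of (P, Q) \<Rightarrow> P \<times> Q) \<inter> (case j of (P, Q) \<Rightarrow> P \<times> Q) = {}"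
        unfolding eq prod.case Times_Int_Times by blast
    qed
  qed
  also have "\<dots> = (\<Sum>(P, Q)\<in>?I. replicate_mset (gcd (card P) (card Q)) (lcm (card P) (card Q)))"
    using block by (intro sum.cong) auto
  also have "\<dots> = cycle_type S f \<odot> cycle_type T g"
    unfolding perm_mult_def cycle_type_def image_mset.compositionality o_def
      sum_unfold_sum_mset[symmetric] by (rule sum.cartesian_product[symmetric])
  finally show ?thesis .
qed

end

theory Submission
  imports Defs
begin

text \<open>
  Put \<open>l = ell A\<close>. Since \<open>l\<close> divides every cycle length of \<open>A\<close>, the product \<open>A C\<^sub>x\<close> depends,
  up to a scalar, only on \<open>lcm l x\<close>: if \<open>c\<close> is the least number with \<open>lcm l c = lcm l x\<close>, then
  \<open>c\<close> divides \<open>x\<close> and \<open>A C\<^sub>x = (x / c) A C\<^sub>c\<close>. Replacing each \<open>C\<^sub>x\<close> by \<open>x / c\<close> copies of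
  \<open>C\<^sub>c\<close> turns any solution into a reduced one, and adds components unless the solution was
  already reduced. For a reduced solution \<open>X\<close>, the shortest cycles of \<open>B = A X\<close> can only come from
  the copies of \<open>C\<^sub>c\<close> with \<open>c = alcm_perm A B\<close>, so each step of the procedure strips exactly those
  copies off \<open>X\<close>. Hence the procedure returns every reduced solution, so there is only one.
\<close>

definition reduced_length :: "nat \<Rightarrow> nat \<Rightarrow> nat" where
  "reduced_length l x = alcm l (lcm l x)"

text \<open>With \<open>c = reduced_length l y\<close>, the \<open>y div c\<close> cycles of length
  \<open>c\<close> have together as many states as one cycle of length \<open>y\<close>, because
  \<open>c\<close> divides \<open>y\<close> for positive \<open>y\<close>.\<close>

definition reduce :: "nat \<Rightarrow> nat multiset \<Rightarrow> nat multiset" where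
  "reduce l Y = (\<Sum>y\<in>#Y. replicate_mset (y div reduced_length l y) (reduced_length l y))"

lemma perm_mult_empty_right [simp]: "A \<odot> {#} = {#}"
  by (simp add: perm_mult_def)

lemma perm_mult_add_right: "A \<odot> (X + Y) = A \<odot> X + A \<odot> Y"
  by (simp add: perm_mult_def sum_mset.distrib)

lemma perm_mult_replicate: "A \<odot> replicate_mset n c = repeat_mset n (A \<odot> {#c#})"
proof (induction n)
  case (Suc n)
  then show ?case
    using perm_mult_add_right[of A "{#c#}" "replicate_mset n c"] by simp
qed simp

lemma in_perm_mult_iff:
  assumes "is_perm A"
  shows "z \<in># A \<odot> X \<longleftrightarrow> (\<exists>a\<in>#A. \<exists>x\<in>#X. z = lcm a x)"
proof -
  have "0 < a" if "a \<in># A" for a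
    using that assms by (auto simp: is_perm_def intro: gr0I)
  then show ?thesis by (fastforce simp: perm_mult_def in_Union_mset_iff)
qed

lemma states_perm_mult: "states (A \<odot> X) = states A * states X"
proof -
  have "states (\<Sum>x\<in>#X. replicate_mset (gcd a x) (lcm a x)) = a * states X" for a
    by (induction X) (simp_all add: states_def prod_gcd_lcm_nat[symmetric] algebra_simps)
  then show ?thesis
    by (induction A) (simp_all add: perm_mult_def states_def algebra_simps)
qed

text \<open>Rests on gcd times lcm being the product, applied to \<open>l * x\<close>,
  \<open>l * y\<close> and \<open>l * gcd x y\<close>. It makes the set of numbers with a prescribed
  lcm with \<open>l\<close> closed under gcd.\<close>

lemma lcm_gcd_distrib_nat: "lcm l (gcd x y) = gcd (lcm l x) (lcm l (y::nat))"
proof (cases "l = 0")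
  case False
  define G where "G = gcd (lcm l x) (lcm l y)"
  define g where "g = gcd l (gcd x y)"
  have "g * G dvd gcd l x * lcm l x" "g * G dvd gcd l y * lcm l y"
    unfolding G_def
    by (intro mult_dvd_mono gcd_dvd1 gcd_dvd2;
        auto simp: g_def intro: dvd_trans[OF gcd_dvd2])+
  then have "g * G dvd gcd (l * x) (l * y)"
    by (simp flip: prod_gcd_lcm_nat)
  also have "gcd (l * x) (l * y) = g * lcm l (gcd x y)"
    by (simp add: g_def gcd_mult_distrib_nat flip: prod_gcd_lcm_nat)
  finally have "g * G dvd g * lcm l (gcd x y)" .
  moreover have "g \<noteq> 0" using False by (simp add: g_def)
  ultimately have "G dvd lcm l (gcd x y)" by simp
  moreover have "lcm l (gcd x y) dvd G"
    by (auto simp: G_def intro: dvd_trans[OF gcd_dvd1] dvd_trans[OF gcd_dvd2])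
  ultimately show ?thesis by (simp add: G_def dvd_antisym)
qed simp

lemma reduced_length:
  assumes "0 < x"
  shows reduced_length_pos: "0 < reduced_length l x"
    and lcm_reduced_length: "lcm l (reduced_length l x) = lcm l x"
    and reduced_length_dvd: "reduced_length l x dvd x"
proof -
  let ?c = "reduced_length l x"
  have *: "0 < ?c \<and> lcm l ?c = lcm l x"
    unfolding reduced_length_def alcm_def by (rule LeastI[of _ x]) (use assms in simp)
  then show "0 < ?c" and "lcm l ?c = lcm l x" by simp_all
  \<comment> \<open>By distributivity \<open>gcd ?c x\<close> again has lcm \<open>lcm l x\<close>
    with \<open>l\<close>, so it competes with the least such number.\<close>
  have "?c \<le> gcd ?c x"
    unfolding reduced_length_def[of l x] alcm_def
    by (rule Least_le) (use * assms in \<open>simp add: lcm_gcd_distrib_nat reduced_length_def alcm_def\<close>)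
  then have "gcd ?c x = ?c"
    using * by (intro le_antisym gcd_le1_nat) auto
  then show "?c dvd x" by (metis gcd_dvd2)
qed

lemma reduced_length_idem:
  "0 < x \<Longrightarrow> reduced_length l (reduced_length l x) = reduced_length l x"
  by (simp add: reduced_length_def[of l "reduced_length l x"] lcm_reduced_length)
    (simp add: reduced_length_def)

text \<open>As \<open>l\<close> divides \<open>a\<close>, \<open>lcm a x\<close> equals
  \<open>lcm a (lcm l x)\<close> and does not change when \<open>x\<close> becomes \<open>c\<close>.
  Since gcd times lcm is the product, the gcd shrinks by the factor \<open>x div c\<close>.\<close>

lemma perm_mult_reduced_length:
  assumes "\<forall>a\<in>#A. l dvd a" and "0 < x"
  defines "c \<equiv> reduced_length l x"
  shows "A \<odot> {#x#} = repeat_mset (x div c) (A \<odot> {#c#})"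
  using assms(1)
proof (induction A)
  case (add a A)
  have c: "0 < c" "c dvd x" "lcm l c = lcm l x"
    using reduced_length[OF assms(2), of l] by (simp_all add: c_def)
  have l: "lcm a l = a" using add.prems by (simp add: lcm_proj1_if_dvd_nat)
  have lcm: "lcm a x = lcm a c"
    by (metis c(3) l lcm.assoc)
  have gcd: "gcd a x = x div c * gcd a c"
  proof (cases "a = 0")
    case False
    have "gcd a x * lcm a c = a * (x div c * c)"
      using c(2) lcm prod_gcd_lcm_nat[of a x] by simp
    also have "\<dots> = x div c * gcd a c * lcm a c"
      using prod_gcd_lcm_nat[of a c] by (simp add: algebra_simps)
    finally show ?thesis using False c(1) by simp
  qed (use c in simp)
  have "replicate_mset (x div c * gcd a c) z = repeat_mset (x div c) (replicate_mset (gcd a c) z)"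
    for z :: nat
    by (rule multiset_eqI) simp
  with add lcm gcd show ?case by (simp add: perm_mult_def)
qed (simp add: perm_mult_def)

lemma perm_mult_reduce:
  assumes "\<forall>a\<in>#A. l dvd a" and "is_perm Y"
  shows "A \<odot> reduce l Y = A \<odot> Y"
  using assms(2)
proof (induction Y)
  case (add y Y)
  then have "0 < y" "is_perm Y" by (auto simp: is_perm_def)
  with add.IH show ?case
    using perm_mult_add_right[of A "{#y#}" Y]
    by (simp add: reduce_def perm_mult_add_right perm_mult_replicate
        perm_mult_reduced_length[OF assms(1)])
qed (simp add: reduce_def)

lemma in_reduce:
  assumes "is_perm Y" and "x \<in># reduce l Y"
  shows "0 < x" and "reduced_length l x = x"
proof -
  obtain y where "y \<in># Y" "x = reduced_length l y"
    using assms(2) by (auto simp: reduce_def in_Union_mset_iff split: if_splits)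
  moreover from this have "0 < y" using assms(1) by (auto simp: is_perm_def intro: gr0I)
  ultimately show "0 < x" and "reduced_length l x = x"
    by (simp_all add: reduced_length_pos reduced_length_idem)
qed

text \<open>Every cycle is replaced by at least one cycle, and by exactly one only if its length is
  already reduced.\<close>

lemma size_reduce:
  assumes "is_perm Y"
  shows "reduce l Y = Y \<or> size Y < size (reduce l Y)"
  using assms
proof (induction Y)
  case (add y Y)
  let ?c = "reduced_length l y"
  have y: "0 < y" and Y: "is_perm Y" using add.prems by (auto simp: is_perm_def)
  have red: "reduce l (add_mset y Y) = replicate_mset (y div ?c) ?c + reduce l Y"
    by (simp add: reduce_def)
  obtain k where k: "y = ?c * k" using reduced_length_dvd[OF y] by (rule dvdE)
  then have k': "y div ?c = k"
    using reduced_length_pos[OF y] by (metis nonzero_mult_div_cancel_left less_not_refl)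
  have "k \<noteq> 0" using y k by (metis mult_0_right less_not_refl)
  then consider "k = 1" | "1 < k" by linarith
  then show ?case
  proof cases
    case 1
    then have "?c = y" using k by simp
    then show ?thesis using red k' 1 add.IH[OF Y] by auto
  next
    case 2
    then show ?thesis using red k' add.IH[OF Y] by auto
  qed
qed (simp add: reduce_def)

text \<open>Each pass removes from \<open>X\<close> all copies of one length, whence strong
  induction on \<open>size X\<close>; \<open>Z\<close> varies because it accumulates the removed
  copies.\<close>

lemma quotient_loop_reduced:
  assumes "is_perm A" and "pseudo_cancelable A"
    and "is_perm X" and "\<forall>x\<in>#X. reduced_length (ell A) x = x"
  shows "quotient_loop A Z (A \<odot> X) = Some (Z + X)"
  using assms(3,4)
proof (induction "size X" arbitrary: X Z rule: less_induct)
  case less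
  show ?case
  proof (cases "X = {#}")
    case True
    then show ?thesis by (simp add: quotient_loop.simps)
  next
    case False
    let ?l = "ell A" and ?B = "A \<odot> X"
    let ?m = "ell ?B"
    define c where "c = alcm_perm A ?B"
    define P where "P = A \<odot> {#c#}"
    define q where "q = count X c"
    define R where "R = filter_mset (\<lambda>x. x \<noteq> c) X"
    have l: "?l \<in># A"
      using assms(2) by (auto simp: ell_def pseudo_cancelable_def intro!: Min_in)
    have dvd: "?l dvd a" if "a \<in># A" for a
      using that assms(2) by (simp add: pseudo_cancelable_def)
    have pos: "0 < x" if "x \<in># A \<or> x \<in># X" for x
      using that assms(1) less.prems(1) by (auto simp: is_perm_def intro: gr0I)
    have in_B: "lcm a x \<in># ?B" if "a \<in># A" "x \<in># X" for a x
      using that in_perm_mult_iff[OF assms(1)] by blast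
    have "?B \<noteq> {#}" using False in_B l by (metis empty_iff multiset_nonemptyE set_mset_empty)
    then have m: "?m \<in># ?B" by (auto simp: ell_def intro!: Min_in)
    \<comment> \<open>\<open>lcm ?l x\<close> is a length in \<open>?B\<close> dividing
      \<open>lcm a x\<close>, so minimality of \<open>?m\<close> forces equality; a reduced
      \<open>x\<close> is recovered from \<open>lcm ?l x\<close> by \<open>alcm\<close>.\<close>
    have shortest: "x = c" if "a \<in># A" "x \<in># X" "?m = lcm a x" for a x
    proof -
      have "?m \<le> lcm ?l x"
        using in_B[OF l that(2)] by (simp add: ell_def)
      moreover have "lcm ?l x \<le> lcm a x"
        using dvd[OF that(1)] pos that(1,2)
        by (intro dvd_imp_le lcm_mono) (auto simp: lcm_pos_nat)
      ultimately have "lcm ?l x = ?m" using that(3) by simp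
      then show ?thesis
        using less.prems(2) that(2) unfolding c_def alcm_perm_def reduced_length_def by metis
    qed
    obtain a x where ax: "a \<in># A" "x \<in># X" "?m = lcm a x"
      using m in_perm_mult_iff[OF assms(1)] by blast
    then have c: "c \<in># X" using shortest by metis
    have l_dvd: "?l dvd ?m"
      using ax(3) dvd[OF ax(1)] by simp
    have m_P: "?m \<in># P"
      using ax shortest[OF ax] by (auto simp: P_def in_perm_mult_iff[OF assms(1)])
    have X: "X = replicate_mset q c + R"
      unfolding q_def R_def by (rule multiset_eqI) simp
    have B: "?B = repeat_mset q P + A \<odot> R"
      by (subst X) (simp add: perm_mult_add_right perm_mult_replicate P_def)
    \<comment> \<open>All cycles of length \<open>?m\<close> in \<open>?B\<close> thus lie in
      \<open>repeat_mset q P\<close>, so the quotient of multiplicities is exactly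
      \<open>q\<close>.\<close>
    have "?m \<notin># A \<odot> R"
      using shortest by (auto simp: in_perm_mult_iff[OF assms(1)] R_def)
    then have "count ?B ?m = q * count P ?m"
      using arg_cong[OF B, of "\<lambda>M. count M ?m"] by (simp add: not_in_iff)
    then have count: "count P ?m dvd count ?B ?m" "count ?B ?m div count P ?m = q"
      using m_P by simp_all
    have q: "0 < q" using c by (simp add: q_def)
    have sub: "repeat_mset q P \<subseteq># ?B" by (subst B) simp
    have "P \<subseteq># repeat_mset q P"
      using q by (auto simp: subseteq_mset_def)
    then have P_sub: "P \<subseteq># ?B" using sub by (rule subset_mset.order_trans)
    \<comment> \<open>State counts multiply, so a nonempty \<open>X\<close> excludes the abort on
      state counts.\<close>
    have "0 < states X"
      using c pos by (metis states_def sum_mset.remove add_gr_0)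
    then have states: "\<not> states ?B < states A"
      by (simp add: states_perm_mult)
    have "?B - repeat_mset q P = A \<odot> R" by (subst B) simp
    then have "quotient_loop A Z ?B = quotient_loop A (Z + replicate_mset q c) (A \<odot> R)"
      using \<open>?B \<noteq> {#}\<close> states P_sub sub l_dvd count
      by (subst quotient_loop.simps) (simp add: Let_def flip: c_def P_def)
    also have "\<dots> = Some (Z + replicate_mset q c + R)"
    proof (rule less.hyps)
      show "size R < size X" using q arg_cong[OF X, of size] by simp
      show "is_perm R" "\<forall>x\<in>#R. reduced_length (ell A) x = x"
        using less.prems by (auto simp: R_def is_perm_def)
    qed
    also have "Z + replicate_mset q c + R = Z + X"
      by (subst X) (simp add: add.assoc)
    finally show ?thesis .
  qed
qed

theorem theorem22:
  fixes A B :: "nat multiset"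
  assumes "is_perm A" and "is_perm B"
    and "pseudo_cancelable A"
    and "\<exists>X. is_perm X \<and> A \<odot> X = B"
  shows "\<exists>X. quotient_procedure A B = Some X \<and> is_perm X \<and> A \<odot> X = B \<and>
    (\<forall>Y. is_perm Y \<and> A \<odot> Y = B \<and> Y \<noteq> X \<longrightarrow> size Y < size X)"
proof -
  have dvd: "\<forall>a\<in>#A. ell A dvd a" using assms(3) by (simp add: pseudo_cancelable_def)
  have perm: "is_perm (reduce (ell A) Y)" if "is_perm Y" for Y
    using in_reduce(1)[OF that] by (auto simp: is_perm_def)
  \<comment> \<open>The left-hand side does not depend on the solution \<open>Y\<close>, so all
    solutions have the same reduction.\<close>
  have proc: "quotient_procedure A B = Some (reduce (ell A) Y)" if "is_perm Y" "A \<odot> Y = B" for Y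
    using quotient_loop_reduced[OF assms(1,3) perm[OF that(1)], of "{#}"] in_reduce(2)[OF that(1)]
      that perm_mult_reduce[OF dvd that(1)]
    by (simp add: quotient_procedure_def)
  obtain Y0 where Y0: "is_perm Y0" "A \<odot> Y0 = B" using assms(4) by blast
  let ?X = "reduce (ell A) Y0"
  \<comment> \<open>The reduction of \<open>Y\<close> is \<open>?X\<close>, which differs from
    \<open>Y\<close>, so only the strict alternative of \<open>size_reduce\<close> remains.\<close>
  have "size Y < size ?X" if "is_perm Y" "A \<odot> Y = B" "Y \<noteq> ?X" for Y
    using proc[OF Y0] proc[OF that(1,2)] size_reduce[OF that(1), of "ell A"] that(3) by auto
  then show ?thesis
    using proc[OF Y0] perm[OF Y0(1)] perm_mult_reduce[OF dvd Y0(1)] Y0(2) by blast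
qed

end
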